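(* Let $X$ be a reflexive Banach space and $T(t)$ be a $C_0$ semigroup on it with generator $A$. Let $\mathcal{N}$ be a Hilbert space and $C:X\to\mathcal{N}$ be a bounded operator. If $(C,A)$ is exponentially detectable, then it is detectable in $L^2$.
   Context: $(C,A)$ is exponentially detectable if there exists a bounded operator $F:\mathcal{N}\to X$ such that $A-FC$ generates an exponentially stable $C_0$ semigroup on $X$, i.e. a $C_0$ semigroup $S(t)$ with $\|S(t)\|\le Me^{-\varepsilon t}$ for all $t\ge0$ and some $M,\varepsilon>0$. $(C,A)$ is detectable in $L^2$ if for all $x\in X$: $\int_0^\infty\|CT(t)x\|^2\,dt<\infty$ implies $\int_0^\infty\|T(t)x\|^2\,dt<\infty$. *)

theory Defs
  imports "HOL-Analysis.Analysis"
begin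

text \<open>
  Scalars are real. Complex Banach and Hilbert spaces are covered through their underlying real
  spaces: a complex-linear bounded operator is real-linear and bounded, norms and (strong) limits
  are unchanged, the real part of a complex inner product is a real one inducing the same norm,
  and a complex Banach space is reflexive iff its underlying real space is.
\<close>

definition reflexive_space :: "'a::real_normed_vector itself \<Rightarrow> bool" where
  "reflexive_space _ \<longleftrightarrow>
     (\<forall>\<phi> :: ('a \<Rightarrow>\<^sub>L real) \<Rightarrow>\<^sub>L real. \<exists>x :: 'a. \<forall>f. blinfun_apply \<phi> f = blinfun_apply f x)"

text \<open>Semigroups are families indexed by real; only their values at t \<open>\<ge>\<close> 0 are meaningful.\<close>

definition C0_semigroup :: "(real \<Rightarrow> 'a::real_normed_vector \<Rightarrow>\<^sub>L 'a) \<Rightarrow> bool" where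
  "C0_semigroup T \<longleftrightarrow>
     T 0 = id_blinfun \<and>
     (\<forall>s\<ge>0. \<forall>t\<ge>0. T (s + t) = T s o\<^sub>L T t) \<and>
     (\<forall>x. ((\<lambda>t. blinfun_apply (T t) x) \<longlongrightarrow> x) (at_right 0))"

text \<open>
  An unbounded operator is given by its domain D and a function A of which only the values on D
  matter. The domain of the generator is exactly the set where the difference quotient converges.
\<close>

definition generates ::
  "'a set \<Rightarrow> ('a \<Rightarrow> 'a) \<Rightarrow> (real \<Rightarrow> 'a::real_normed_vector \<Rightarrow>\<^sub>L 'a) \<Rightarrow> bool" where
  "generates D A T \<longleftrightarrow>
     D = {x. \<exists>y. ((\<lambda>h. (blinfun_apply (T h) x - x) /\<^sub>R h) \<longlongrightarrow> y) (at_right 0)} \<and>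
     (\<forall>x\<in>D. ((\<lambda>h. (blinfun_apply (T h) x - x) /\<^sub>R h) \<longlongrightarrow> A x) (at_right 0))"

definition exponentially_stable :: "(real \<Rightarrow> 'a::real_normed_vector \<Rightarrow>\<^sub>L 'a) \<Rightarrow> bool" where
  "exponentially_stable S \<longleftrightarrow>
     (\<exists>M>0. \<exists>\<epsilon>>0. \<forall>t\<ge>0. norm (S t) \<le> M * exp (- \<epsilon> * t))"

text \<open>As C and F are bounded, A - FC has the same domain D as A.\<close>

definition exponentially_detectable ::
  "('a::real_normed_vector \<Rightarrow>\<^sub>L 'n::real_normed_vector) \<Rightarrow> 'a set \<Rightarrow> ('a \<Rightarrow> 'a) \<Rightarrow> bool" where
  "exponentially_detectable C D A \<longleftrightarrow>
     (\<exists>(F :: 'n \<Rightarrow>\<^sub>L 'a) S. C0_semigroup S \<and>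
        generates D (\<lambda>x. A x - blinfun_apply F (blinfun_apply C x)) S \<and>
        exponentially_stable S)"

text \<open>
  Detectability refers to the semigroup T generated by A. For a \<open>C\<^sub>0\<close> semigroup the integrands
  are continuous on the half-line, so their integrals in the extended nonnegative reals are the
  ordinary ones, with value \<open>\<infinity>\<close> in case of divergence.
\<close>

definition detectable_L2 ::
  "('a::real_normed_vector \<Rightarrow>\<^sub>L 'n::real_normed_vector) \<Rightarrow> (real \<Rightarrow> 'a \<Rightarrow>\<^sub>L 'a) \<Rightarrow> bool" where
  "detectable_L2 C T \<longleftrightarrow>
     (\<forall>x. (\<integral>\<^sup>+t\<in>{0..}. ennreal ((norm (blinfun_apply C (blinfun_apply (T t) x)))\<^sup>2) \<partial>lborel) < \<infinity> \<longrightarrow>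
          (\<integral>\<^sup>+t\<in>{0..}. ennreal ((norm (blinfun_apply (T t) x))\<^sup>2) \<partial>lborel) < \<infinity>)"

end

theory Submission
  imports Defs
begin

text \<open>
  On the common domain \<open>D\<close>, \<open>u s = S (t - s) (T s x)\<close> has the right derivative
  \<open>S (t - s) (F (C (T s x)))\<close>, since both generators differ by \<open>F C\<close>. Integrating its norm gives
  \<open>norm (T t x) \<le> b t\<close> with \<open>b' = - \<epsilon> b + K f\<close>, \<open>f t = norm (C (T t x))\<close> and
  \<open>b 0\<close> a multiple of \<open>norm x\<close>; both sides are continuous in \<open>x\<close> and \<open>D\<close> is dense, so this holds
  everywhere. Finally \<open>(b\<^sup>2)' \<le> - \<epsilon> b\<^sup>2 + K\<^sup>2 f\<^sup>2 / \<epsilon>\<close>, so \<open>b\<close> is square integrable whenever \<open>f\<close> is.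
\<close>

section \<open>Operator families: uniform boundedness and strong limits\<close>

text \<open>Banach-Steinhaus by Baire category: the closed sets \<open>E n\<close> of points at
  which all of \<open>F\<close> is bounded by \<open>n\<close> cover the space, so one of them
  contains a ball. Differences of points of that ball bound every member of \<open>F\<close> on
  small vectors.\<close>

lemma uniform_boundedness_blinfun:
  fixes F :: "('a::banach \<Rightarrow>\<^sub>L 'b::real_normed_vector) set"
  assumes "\<And>x. \<exists>B. \<forall>f\<in>F. norm (blinfun_apply f x) \<le> B"
  shows "\<exists>B. \<forall>f\<in>F. norm f \<le> B"
proof -
  define E where "E n = {x. \<forall>f\<in>F. norm (blinfun_apply f x) \<le> real n}" for n :: nat
  have clo: "closed (E n)" for n
  proof -
    have "E n = (\<Inter>f\<in>F. {x. norm (blinfun_apply f x) \<le> real n})"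
      by (auto simp: E_def)
    moreover have "closed {x. norm (blinfun_apply f x) \<le> real n}" for f :: "'a \<Rightarrow>\<^sub>L 'b"
      by (intro closed_Collect_le continuous_intros)
    ultimately show ?thesis
      by auto
  qed
  have cover: "\<Union>(range E) = UNIV"
  proof -
    have "\<exists>n. x \<in> E n" for x
    proof -
      obtain B where B: "\<forall>f\<in>F. norm (blinfun_apply f x) \<le> B"
        using assms by blast
      obtain n where "B \<le> real n"
        using real_arch_simple by blast
      with B have "x \<in> E n"
        unfolding E_def by fastforce
      then show ?thesis ..
    qed
    then show ?thesis by auto
  qed
  have "\<exists>n. interior (E n) \<noteq> {}"
  \<comment> \<open>Baire: a countable union of closed sets with empty interior has empty interior,
    whereas the union here is the whole space.\<close>
  proof (rule ccontr)
    assume "\<nexists>n. interior (E n) \<noteq> {}"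
    then have "euclidean interior_of \<Union>(range E) = {}"
      by (intro Baire_category_alt) (auto simp: completely_metrizable_space_euclidean clo)
    then show False
      by (simp add: cover)
  qed
  then obtain n x0 where "x0 \<in> interior (E n)"
    by blast
  then obtain r where r: "r > 0" "ball x0 r \<subseteq> E n"
    by (meson mem_interior)
  \<comment> \<open>Rescaling \<open>y\<close> to length \<open>r / 2\<close> keeps
    \<open>x0 + z\<close> inside the ball. The values at \<open>x0 + z\<close> and \<open>x0\<close>
    contribute \<open>2 * n\<close>, and undoing the scaling gives the factor
    \<open>2 / r\<close>.\<close>
  have "norm f \<le> 4 * real n / r" if f: "f \<in> F" for f
  proof (rule norm_blinfun_bound)
    show "0 \<le> 4 * real n / r"
      using r by simp
    fix y
    show "norm (blinfun_apply f y) \<le> 4 * real n / r * norm y"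
    proof (cases "y = 0")
      case False
      define z where "z = (r / (2 * norm y)) *\<^sub>R y"
      have "norm z = r / 2"
        using False r by (simp add: z_def)
      then have "x0 + z \<in> ball x0 r" "x0 \<in> ball x0 r"
        using r by (auto simp: dist_norm)
      then have "x0 + z \<in> E n" "x0 \<in> E n"
        using r by auto
      then have 1: "norm (blinfun_apply f (x0 + z)) \<le> real n" "norm (blinfun_apply f x0) \<le> real n"
        using f by (auto simp: E_def)
      have "norm (blinfun_apply f z) = norm (blinfun_apply f (x0 + z) - blinfun_apply f x0)"
        by (simp add: blinfun.add_right)
      also have "\<dots> \<le> 2 * real n"
        using norm_triangle_ineq4[of "blinfun_apply f (x0 + z)" "blinfun_apply f x0"] 1 by linarith
      finally have "r / (2 * norm y) * norm (blinfun_apply f y) \<le> 2 * real n"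
        using r by (simp add: z_def blinfun.scaleR_right)
      then show ?thesis
        using False r by (simp add: field_simps)
    qed simp
  qed
  then show ?thesis by blast
qed

text \<open>Splitting \<open>v i\<close> as \<open>(v i - y) + y\<close>, the norm bound makes the
  first contribution vanish. This serves products of a strongly continuous family with a moving
  vector.\<close>

lemma tendsto_blinfun_apply_bounded:
  fixes S :: "'i \<Rightarrow> 'a::real_normed_vector \<Rightarrow>\<^sub>L 'b::real_normed_vector"
  assumes "\<forall>\<^sub>F i in F. norm (S i) \<le> M"
    and "((\<lambda>i. blinfun_apply (S i) y) \<longlongrightarrow> z) F"
    and "(v \<longlongrightarrow> y) F"
  shows "((\<lambda>i. blinfun_apply (S i) (v i)) \<longlongrightarrow> z) F"
proof -
  have "((\<lambda>i. M * norm (v i - y)) \<longlongrightarrow> M * norm (y - y)) F"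
    by (intro tendsto_intros assms)
  then have 1: "((\<lambda>i. M * norm (v i - y)) \<longlongrightarrow> 0) F"
    by simp
  have "((\<lambda>i. blinfun_apply (S i) (v i - y)) \<longlongrightarrow> 0) F"
  proof (rule Lim_null_comparison[OF _ 1])
    show "\<forall>\<^sub>F i in F. norm (blinfun_apply (S i) (v i - y)) \<le> M * norm (v i - y)"
      using assms(1)
      by eventually_elim (meson mult_right_mono norm_blinfun norm_ge_zero order_trans)
  qed
  from tendsto_add[OF this assms(2)] show ?thesis
    by (simp add: blinfun.diff_right)
qed

section \<open>Local boundedness and strong continuity of semigroups\<close>

lemma C0_semigroup_zero: "C0_semigroup T \<Longrightarrow> blinfun_apply (T 0) x = x"
  by (simp add: C0_semigroup_def)

lemma C0_semigroup_add:
  "C0_semigroup T \<Longrightarrow> 0 \<le> s \<Longrightarrow> 0 \<le> t \<Longrightarrow>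
    blinfun_apply (T (s + t)) x = blinfun_apply (T s) (blinfun_apply (T t) x)"
  by (simp add: C0_semigroup_def)

lemma C0_semigroup_tendsto:
  "C0_semigroup T \<Longrightarrow> ((\<lambda>t. blinfun_apply (T t) x) \<longlongrightarrow> x) (at_right 0)"
  by (simp add: C0_semigroup_def)

text \<open>Otherwise the norms would be unbounded along some times tending to 0. Each orbit
  converges along these times, hence is bounded there, which contradicts uniform
  boundedness.\<close>

lemma C0_semigroup_bounded_near_0:
  fixes T :: "real \<Rightarrow> 'a::banach \<Rightarrow>\<^sub>L 'a"
  assumes T: "C0_semigroup T"
  shows "\<exists>\<delta>>0. \<exists>M. \<forall>t\<in>{0..\<delta>}. norm (T t) \<le> M"
proof (rule ccontr)
  assume neg: "\<not> ?thesis"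
  have "\<exists>t. t \<in> {0..inverse (real (Suc n))} \<and> norm (T t) > real n" for n
  proof -
    have "\<not> (\<forall>t\<in>{0..inverse (real (Suc n))}. norm (T t) \<le> real n)"
      using neg by (metis inverse_positive_iff_positive of_nat_0_less_iff zero_less_Suc)
    then show ?thesis
      by (auto simp: not_le)
  qed
  then obtain \<tau> where \<tau>: "\<And>n. \<tau> n \<in> {0..inverse (real (Suc n))}" "\<And>n. norm (T (\<tau> n)) > real n"
    by metis
  have \<tau>0: "\<tau> \<longlonglongrightarrow> 0"
    by (rule tendsto_sandwich[OF _ _ tendsto_const LIMSEQ_inverse_real_of_nat]) (use \<tau> in auto)
  have "\<exists>B. \<forall>f\<in>range (\<lambda>n. T (\<tau> n)). norm (blinfun_apply f x) \<le> B" for x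
  proof -
    \<comment> \<open>The interval that contains \<open>\<tau> n\<close> includes 0, so the limit
      from the right is restated as continuity within the closed half-line.\<close>
    have "continuous (at 0 within {0..}) (\<lambda>t. blinfun_apply (T t) x)"
      using C0_semigroup_tendsto[OF T, of x] C0_semigroup_zero[OF T, of x]
      by (simp add: continuous_within at_within_Ici_at_right)
    then have "(\<lambda>n. blinfun_apply (T (\<tau> n)) x) \<longlonglongrightarrow> blinfun_apply (T 0) x"
      by (rule continuous_within_tendsto_compose'[rotated 2, OF \<tau>0]) (use \<tau> in auto)
    then have "Bseq (\<lambda>n. blinfun_apply (T (\<tau> n)) x)"
      by (intro convergent_imp_Bseq convergentI)
    then show ?thesis
      by (auto simp: Bseq_def)
  qed
  from uniform_boundedness_blinfun[OF this]
  obtain B where "\<And>n. norm (T (\<tau> n)) \<le> B"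
    by auto
  moreover obtain n where "B \<le> real n"
    using real_arch_simple by blast
  ultimately show False
    using \<tau>(2)[of n] by (metis not_le order_trans)
qed

text \<open>The semigroup law reaches \<open>b\<close> in finitely many steps of length
  \<open>\<delta>\<close>, each costing a factor \<open>M\<close>.\<close>

lemma C0_semigroup_locally_bounded:
  fixes T :: "real \<Rightarrow> 'a::banach \<Rightarrow>\<^sub>L 'a"
  assumes T: "C0_semigroup T"
  shows "\<exists>M\<ge>0. \<forall>t\<in>{0..b}. norm (T t) \<le> M"
proof -
  obtain \<delta> M0 where \<delta>: "\<delta> > 0" and M0: "\<And>t. t \<in> {0..\<delta>} \<Longrightarrow> norm (T t) \<le> M0"
    using C0_semigroup_bounded_near_0[OF T] by blast
  \<comment> \<open>With \<open>M \<ge> 1\<close> the powers of \<open>M\<close> increase, so the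
    bound for several steps also covers times below \<open>\<delta>\<close>.\<close>
  define M where "M = max M0 1"
  have M: "norm (T t) \<le> M" if "t \<in> {0..\<delta>}" for t
    using M0[OF that] by (simp add: M_def)
  have M1: "M \<ge> 1"
    by (simp add: M_def)
  have *: "\<forall>t\<in>{0..real n * \<delta>}. norm (T t) \<le> M ^ Suc n" for n
  proof (induction n)
    case 0
    show ?case
      using M[of 0] \<delta> by auto
  next
    case (Suc n)
    show ?case
    proof
      fix t assume t: "t \<in> {0..real (Suc n) * \<delta>}"
      show "norm (T t) \<le> M ^ Suc (Suc n)"
      proof (cases "t \<le> \<delta>")
        case True
        then have "norm (T t) \<le> M"
          using t M by auto
        also have "M \<le> M ^ Suc (Suc n)"
          using M1 by (intro self_le_power) auto
        finally show ?thesis .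
      next
        case False
        then have "T t = T \<delta> o\<^sub>L T (t - \<delta>)"
          using T \<delta> unfolding C0_semigroup_def
          by (metis add_diff_cancel_left' diff_add_cancel add.commute diff_ge_0_iff_ge less_eq_real_def linorder_not_le)
        then have "norm (T t) \<le> norm (T \<delta>) * norm (T (t - \<delta>))"
          using norm_blinfun_compose by metis
        also have "\<dots> \<le> M * M ^ Suc n"
          using False t Suc \<delta> M[of \<delta>] M1
          by (intro mult_mono) (auto simp: algebra_simps)
        finally show ?thesis by simp
      qed
    qed
  qed
  obtain n where "b / \<delta> \<le> real n"
    using real_arch_simple by blast
  then have "b \<le> real n * \<delta>"
    using \<delta> by (simp add: field_simps)
  then have "\<forall>t\<in>{0..b}. norm (T t) \<le> M ^ Suc n"
    using *[of n] by auto
  then show ?thesis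
    using M1 by (intro exI[of _ "M ^ Suc n"]) auto
qed

text \<open>Both one-sided limits at \<open>t\<close> reduce to the limit at 0 from the right: the
  operator at the earlier of two times is factored out, and its norm is locally bounded.\<close>

lemma C0_semigroup_continuous:
  fixes T :: "real \<Rightarrow> 'a::banach \<Rightarrow>\<^sub>L 'a"
  assumes T: "C0_semigroup T"
  shows "continuous_on {0..} (\<lambda>t. blinfun_apply (T t) x)"
  unfolding continuous_on_iff
proof (intro ballI allI impI)
  fix t e :: real
  assume t: "t \<in> {0..}" and e: "e > 0"
  obtain M where M: "M \<ge> 0" "\<And>s. s \<in> {0..t + 1} \<Longrightarrow> norm (T s) \<le> M"
    using C0_semigroup_locally_bounded[OF T] by blast
  have mono: "norm (blinfun_apply (T s) x - blinfun_apply (T r) x) \<le> M * norm (blinfun_apply (T (s - r)) x - x)"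
    if "0 \<le> r" "r \<le> s" "s \<le> t + 1" for r s
  proof -
    have "blinfun_apply (T s) x = blinfun_apply (T r) (blinfun_apply (T (s - r)) x)"
      using C0_semigroup_add[OF T, of r "s - r"] that by simp
    then have "norm (blinfun_apply (T s) x - blinfun_apply (T r) x)
        = norm (blinfun_apply (T r) (blinfun_apply (T (s - r)) x - x))"
      by (simp add: blinfun.diff_right)
    also have "\<dots> \<le> norm (T r) * norm (blinfun_apply (T (s - r)) x - x)"
      by (rule norm_blinfun)
    also have "\<dots> \<le> M * norm (blinfun_apply (T (s - r)) x - x)"
      using that by (intro mult_right_mono M) auto
    finally show ?thesis .
  qed
  \<comment> \<open>\<open>M\<close> may be 0, hence the denominator \<open>M + 1\<close>.\<close>
  have "\<forall>\<^sub>F h in at_right 0. dist (blinfun_apply (T h) x) x < e / (M + 1)"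
    using tendstoD[OF C0_semigroup_tendsto[OF T]] e M by simp
  then obtain d where d: "d > 0" "\<And>h. 0 < h \<Longrightarrow> h < d \<Longrightarrow> norm (blinfun_apply (T h) x - x) < e / (M + 1)"
    by (auto simp: eventually_at_right_field dist_norm)
  have small: "M * norm (blinfun_apply (T h) x - x) < e" if h: "0 < h" "h < d" for h
  proof -
    have "M * norm (blinfun_apply (T h) x - x) \<le> M * (e / (M + 1))"
      using d(2)[OF h] M by (intro mult_left_mono) auto
    also have "\<dots> < e"
      using M e by (simp add: field_simps)
    finally show ?thesis .
  qed
  show "\<exists>d>0. \<forall>s\<in>{0..}. dist s t < d \<longrightarrow> dist (blinfun_apply (T s) x) (blinfun_apply (T t) x) < e"
  \<comment> \<open>The 1 keeps \<open>s\<close> below \<open>t + 1\<close>, where \<open>M\<close>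
    bounds the semigroup.\<close>
  proof (intro exI[of _ "min d 1"] conjI ballI impI)
    fix s :: real
    assume s: "s \<in> {0..}" "dist s t < min d 1"
    consider "s = t" | "s < t" | "t < s" by linarith
    then show "dist (blinfun_apply (T s) x) (blinfun_apply (T t) x) < e"
    proof cases
      case 2
      then show ?thesis
        using s t mono[of s t] small[of "t - s"]
        by (simp add: dist_norm norm_minus_commute)
    next
      case 3
      then show ?thesis
        using s t mono[of t s] small[of "s - t"]
        by (simp add: dist_norm)
    qed (use e in simp)
  qed (use d in auto)
qed

section \<open>A mean value inequality for right derivatives\<close>

text \<open>With a slack \<open>e * (s - a)\<close> added, the inequality holds on a compact set of
  points \<open>s\<close>. The right derivatives push it beyond any such point below
  \<open>b\<close>, so the greatest one is \<open>b\<close>.\<close>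

lemma norm_increment_le_right_derivative:
  fixes u :: "real \<Rightarrow> 'a::real_normed_vector" and G :: "real \<Rightarrow> real"
  assumes ab: "a \<le> b" and u: "continuous_on {a..b} u" and G: "continuous_on {a..b} G"
    and du: "\<And>s. a \<le> s \<Longrightarrow> s < b \<Longrightarrow> ((\<lambda>h. (u (s + h) - u s) /\<^sub>R h) \<longlongrightarrow> u' s) (at_right 0)"
    and dG: "\<And>s. a \<le> s \<Longrightarrow> s < b \<Longrightarrow> ((\<lambda>h. (G (s + h) - G s) / h) \<longlongrightarrow> G' s) (at_right 0)"
    and le: "\<And>s. a \<le> s \<Longrightarrow> s < b \<Longrightarrow> norm (u' s) \<le> G' s"
  shows "norm (u b - u a) \<le> G b - G a"
proof (rule field_le_epsilon)
  fix e0 :: real assume e0: "e0 > 0"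
  \<comment> \<open>The slack over the whole interval is then at most \<open>e0\<close>; the added 1
    keeps the denominator positive when \<open>a = b\<close>.\<close>
  define e where "e = e0 / (b - a + 1)"
  have e: "e > 0"
    using e0 ab by (simp add: e_def)
  define P where "P = {s\<in>{a..b}. norm (u s - u a) \<le> G s - G a + e * (s - a)}"
  have "closed P"
    unfolding P_def using u G by (intro continuous_on_closed_Collect_le continuous_intros) auto
  moreover have "bounded P"
    by (rule bounded_subset[of "{a..b}"]) (auto simp: P_def)
  ultimately have "compact P"
    by (simp add: compact_eq_bounded_closed)
  moreover have "a \<in> P"
    using ab by (simp add: P_def)
  ultimately obtain c where c: "c \<in> P" "\<And>s. s \<in> P \<Longrightarrow> s \<le> c"
    using compact_attains_sup[of P] by blast
  have "c = b"
  proof (rule ccontr)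
    assume "c \<noteq> b"
    then have cb: "a \<le> c" "c < b"
      using c by (auto simp: P_def)
    \<comment> \<open>Each difference quotient may err by \<open>e / 2\<close>; together this costs
      \<open>e * h\<close>, exactly the growth of the slack in \<open>P\<close> from
      \<open>c\<close> to \<open>c + h\<close>.\<close>
    have "\<forall>\<^sub>F h in at_right 0. dist ((u (c + h) - u c) /\<^sub>R h) (u' c) < e / 2"
      by (rule tendstoD[OF du[OF cb]]) (use e in simp)
    moreover have "\<forall>\<^sub>F h in at_right 0. dist ((G (c + h) - G c) / h) (G' c) < e / 2"
      by (rule tendstoD[OF dG[OF cb]]) (use e in simp)
    moreover have "\<forall>\<^sub>F h in at_right (0::real). 0 < h \<and> h < b - c"
      using cb by (auto simp: eventually_at_right_field intro!: exI[of _ "b - c"])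
    ultimately have "\<forall>\<^sub>F h in at_right 0. c + h \<in> P \<and> h > 0"
    proof eventually_elim
      case (elim h)
      have "norm ((u (c + h) - u c) /\<^sub>R h) \<le> norm (u' c) + e / 2"
        using elim(1) norm_triangle_ineq2[of "(u (c + h) - u c) /\<^sub>R h" "u' c"]
        unfolding dist_norm by linarith
      also have "\<dots> \<le> (G (c + h) - G c) / h + e"
        using elim(2) le[OF cb] unfolding dist_real_def by linarith
      finally have "norm (u (c + h) - u c) / h \<le> (G (c + h) - G c) / h + e"
        using elim(3) by (simp add: divide_inverse mult.commute)
      then have "norm (u (c + h) - u c) \<le> G (c + h) - G c + e * h"
        using elim(3) by (simp add: field_simps)
      moreover have "norm (u c - u a) \<le> G c - G a + e * (c - a)"
        using c by (simp add: P_def)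
      moreover have "norm (u (c + h) - u a) \<le> norm (u (c + h) - u c) + norm (u c - u a)"
        using norm_triangle_ineq[of "u (c + h) - u c" "u c - u a"] by simp
      ultimately show ?case
        using elim(3) cb by (simp add: P_def algebra_simps)
    qed
    then have "\<exists>h. c + h \<in> P \<and> h > (0::real)"
      by (rule eventually_happens'[rotated]) simp
    then show False
      using c(2) by force
  qed
  then have "norm (u b - u a) \<le> G b - G a + e * (b - a)"
    using c by (simp add: P_def)
  also have "e * (b - a) \<le> e0"
    using ab e0 by (simp add: e_def field_simps)
  finally show "norm (u b - u a) \<le> G b - G a + e0"
    by simp
qed

section \<open>Generators: invariance and density of the domain\<close>

text \<open>\<open>T s\<close> commutes with \<open>T h\<close>, so it maps the difference quotient
  at \<open>x\<close> to the one at \<open>T s x\<close>, and boundedness of \<open>T s\<close>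
  preserves convergence.\<close>

lemma generates_invariant:
  assumes T: "C0_semigroup T" and gen: "generates D A T" and x: "x \<in> D" and s: "0 \<le> s"
  shows "blinfun_apply (T s) x \<in> D"
proof -
  have "((\<lambda>h. (blinfun_apply (T h) x - x) /\<^sub>R h) \<longlongrightarrow> A x) (at_right 0)"
    using gen x by (simp add: generates_def)
  then have "((\<lambda>h. blinfun_apply (T s) ((blinfun_apply (T h) x - x) /\<^sub>R h))
      \<longlongrightarrow> blinfun_apply (T s) (A x)) (at_right 0)"
    by (intro tendsto_intros)
  moreover have "\<forall>\<^sub>F h in at_right 0. blinfun_apply (T s) ((blinfun_apply (T h) x - x) /\<^sub>R h)
      = (blinfun_apply (T h) (blinfun_apply (T s) x) - blinfun_apply (T s) x) /\<^sub>R h"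
    using eventually_at_right_less[of "0::real"]
  proof eventually_elim
    case (elim h)
    then have "blinfun_apply (T s) (blinfun_apply (T h) x) = blinfun_apply (T h) (blinfun_apply (T s) x)"
      using C0_semigroup_add[OF T, of s h x] C0_semigroup_add[OF T, of h s x] s
      by (simp add: add.commute)
    then show ?case
      by (simp add: blinfun.scaleR_right blinfun.diff_right)
  qed
  ultimately have "((\<lambda>h. (blinfun_apply (T h) (blinfun_apply (T s) x) - blinfun_apply (T s) x) /\<^sub>R h)
      \<longlongrightarrow> blinfun_apply (T s) (A x)) (at_right 0)"
    by (rule Lim_transform_eventually)
  then show ?thesis
    using gen by (auto simp: generates_def)
qed

text \<open>The fundamental theorem of calculus, recast with increments tending to 0 from the right
  to match the quotients in \<open>generates\<close>.\<close>

lemma integral_has_right_derivative: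
  fixes f :: "real \<Rightarrow> 'a::banach"
  assumes f: "continuous_on {a..b} f" and s: "a \<le> s" "s < b"
  shows "((\<lambda>h. (integral {a..s + h} f - integral {a..s} f) /\<^sub>R h) \<longlongrightarrow> f s) (at_right 0)"
proof -
  have "((\<lambda>u. integral {a..u} f) has_vector_derivative f s) (at s within {a..b})"
    using s by (intro integral_has_vector_derivative[OF f]) auto
  then have "((\<lambda>u. integral {a..u} f) has_vector_derivative f s) (at s within {s..b})"
    by (rule has_vector_derivative_within_subset) (use s in auto)
  then have "((\<lambda>u. (1 / norm (u - s)) *\<^sub>R (integral {a..u} f - (integral {a..s} f + (u - s) *\<^sub>R f s)))
      \<longlongrightarrow> 0) (at_right s)"
    using s by (simp add: has_vector_derivative_def has_derivative_within at_within_Icc_at_right)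
  then have "((\<lambda>h. (1 / norm h) *\<^sub>R (integral {a..s + h} f - (integral {a..s} f + h *\<^sub>R f s)))
      \<longlongrightarrow> 0) (at_right 0)"
    by (subst (asm) filterlim_at_right_to_0) (simp add: add.commute)
  moreover have "\<forall>\<^sub>F h in at_right 0. (1 / norm h) *\<^sub>R (integral {a..s + h} f - (integral {a..s} f + h *\<^sub>R f s))
      = (integral {a..s + h} f - integral {a..s} f) /\<^sub>R h - f s"
    using eventually_at_right_less[of "0::real"]
    by eventually_elim (simp add: algebra_simps divide_inverse)
  ultimately have "((\<lambda>h. (integral {a..s + h} f - integral {a..s} f) /\<^sub>R h - f s) \<longlongrightarrow> 0) (at_right 0)"
    by (rule Lim_transform_eventually)
  then show ?thesis
    by (rule LIM_zero_cancel)
qed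

text \<open>The averages \<open>I k /\<^sub>R k\<close> of the orbit of \<open>x\<close> lie in the
  domain and tend to \<open>x\<close> as \<open>k\<close> decreases to 0.\<close>

lemma generator_domain_dense:
  fixes T :: "real \<Rightarrow> 'a::banach \<Rightarrow>\<^sub>L 'a"
  assumes T: "C0_semigroup T" and gen: "generates D A T"
  shows "closure D = UNIV"
proof -
  have "x \<in> closure D" for x
  proof -
    define I where "I h = integral {0..h} (\<lambda>r. blinfun_apply (T r) x)" for h
    have cont: "continuous_on {a..b} (\<lambda>r. blinfun_apply (T r) x)" if "0 \<le> a" for a b
      by (rule continuous_on_subset[OF C0_semigroup_continuous[OF T]]) (use that in auto)
    have dI: "((\<lambda>k. (I (h + k) - I h) /\<^sub>R k) \<longlongrightarrow> blinfun_apply (T h) x) (at_right 0)" if "0 \<le> h" for h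
      unfolding I_def by (rule integral_has_right_derivative[OF cont[of 0 "h + 1"]]) (use that in auto)
    \<comment> \<open>Applying \<open>T k\<close> moves the window of integration by
      \<open>k\<close>.\<close>
    have shift: "blinfun_apply (T k) (I h) = I (h + k) - I k" if hk: "0 \<le> h" "0 \<le> k" for h k
    proof -
      have "blinfun_apply (T k) (I h) = integral {0..h} (\<lambda>r. blinfun_apply (T k) (blinfun_apply (T r) x))"
        unfolding I_def
        by (rule integral_blinfun_apply[symmetric]) (intro integrable_continuous_real cont, simp)
      also have "\<dots> = integral {0..h} (\<lambda>r. blinfun_apply (T (r + k)) x)"
        using hk by (intro integral_cong) (simp add: C0_semigroup_add[OF T, symmetric] add.commute[of _ k])
      also have "\<dots> = integral {0 + k..h + k} (\<lambda>r. blinfun_apply (T r) x)"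
        using integral_shift_Icc_real[of 0 h "\<lambda>r. blinfun_apply (T r) x" k]
        by (simp add: o_def add.commute)
      also have "\<dots> = I (h + k) - I k"
        using hk Henstock_Kurzweil_Integration.integral_combine
            [where a = 0 and c = k and b = "h + k" and f = "\<lambda>r. blinfun_apply (T r) x"]
          integrable_continuous_real[OF cont[of 0 "h + k"]]
        unfolding I_def by (simp add: algebra_simps)
      finally show ?thesis .
    qed
    have ID: "I h \<in> D" if h: "0 \<le> h" for h
    proof -
      \<comment> \<open>By the shift identity, the quotient of the semigroup at \<open>I h\<close>
        is the difference of the quotients of \<open>I\<close> at \<open>h\<close> and at 0.\<close>
      have "((\<lambda>k. (I (h + k) - I h) /\<^sub>R k - (I (0 + k) - I 0) /\<^sub>R k)
          \<longlongrightarrow> blinfun_apply (T h) x - blinfun_apply (T 0) x) (at_right 0)"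
        by (intro tendsto_diff dI h order_refl)
      moreover have "\<forall>\<^sub>F k in at_right 0. (I (h + k) - I h) /\<^sub>R k - (I (0 + k) - I 0) /\<^sub>R k
          = (blinfun_apply (T k) (I h) - I h) /\<^sub>R k"
        using eventually_at_right_less[of "0::real"]
      proof eventually_elim
        case (elim k)
        have "I 0 = 0"
          by (simp add: I_def)
        then show ?case
          using shift[OF h, of k] elim by (simp add: scaleR_diff_right)
      qed
      ultimately have "((\<lambda>k. (blinfun_apply (T k) (I h) - I h) /\<^sub>R k)
          \<longlongrightarrow> blinfun_apply (T h) x - blinfun_apply (T 0) x) (at_right 0)"
        by (rule Lim_transform_eventually)
      then show ?thesis
        using gen by (auto simp: generates_def)
    qed
    have scale: "c *\<^sub>R z \<in> D" if "z \<in> D" for c z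
    proof -
      have "((\<lambda>h. (blinfun_apply (T h) z - z) /\<^sub>R h) \<longlongrightarrow> A z) (at_right 0)"
        using gen that by (simp add: generates_def)
      then have "((\<lambda>h. c *\<^sub>R ((blinfun_apply (T h) z - z) /\<^sub>R h)) \<longlongrightarrow> c *\<^sub>R A z) (at_right 0)"
        by (intro tendsto_intros)
      then have "((\<lambda>h. (blinfun_apply (T h) (c *\<^sub>R z) - c *\<^sub>R z) /\<^sub>R h) \<longlongrightarrow> c *\<^sub>R A z) (at_right 0)"
        by (simp add: blinfun.scaleR_right scaleR_diff_right mult.commute)
      then show ?thesis
        using gen by (auto simp: generates_def)
    qed
    have "\<forall>\<^sub>F k in at_right 0. I k /\<^sub>R k \<in> closure D"
      using eventually_at_right_less[of "0::real"]
      by eventually_elim (intro closure_subset[THEN subsetD] scale ID less_imp_le)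
    moreover have "((\<lambda>k. I k /\<^sub>R k) \<longlongrightarrow> x) (at_right 0)"
      using dI[of 0] C0_semigroup_zero[OF T] by (simp add: I_def)
    ultimately show ?thesis
      by (intro Lim_in_closed_set[OF closed_closure]) simp_all
  qed
  then show ?thesis by auto
qed

section \<open>Estimating one semigroup by the other and the output\<close>

text \<open>This is the norm form of the variation of constants formula, in which
  \<open>T t x\<close> is \<open>S t x\<close> plus the integral of
  \<open>S (t - s) (F (C (T s x)))\<close>. It results from comparing the right derivatives of
  \<open>u\<close> and of the scalar majorant \<open>G\<close>.\<close>

lemma feedback_estimate_domain:
  fixes T S :: "real \<Rightarrow> 'a::banach \<Rightarrow>\<^sub>L 'a" and F :: "'n::real_normed_vector \<Rightarrow>\<^sub>L 'a"
  assumes T: "C0_semigroup T" and S: "C0_semigroup S"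
    and genT: "generates D A T"
    and genS: "generates D (\<lambda>x. A x - blinfun_apply F (blinfun_apply C x)) S"
    and bound: "\<And>t. 0 \<le> t \<Longrightarrow> norm (S t) \<le> M * exp (- \<epsilon> * t)"
    and x: "x \<in> D" and t: "0 \<le> t"
  shows "norm (blinfun_apply (T t) x) \<le> exp (- \<epsilon> * t) * (M * norm x +
    M * norm F * integral {0..t} (\<lambda>s. exp (\<epsilon> * s) * norm (blinfun_apply C (blinfun_apply (T s) x))))"
proof -
  define \<phi> where "\<phi> s = exp (\<epsilon> * s) * norm (blinfun_apply C (blinfun_apply (T s) x))" for s
  define u where "u s = blinfun_apply (S (t - s)) (blinfun_apply (T s) x)" for s
  \<comment> \<open>The derivative of \<open>G\<close> at \<open>s\<close> is the bound on the right
    derivative of \<open>u\<close>, with \<open>exp (- \<epsilon> * (t - s))\<close> split so that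
    the factor depending on \<open>t\<close> leaves the integral.\<close>
  define G where "G s = M * norm F * exp (- \<epsilon> * t) * integral {0..s} \<phi>" for s
  have contT: "continuous_on {0..t} (\<lambda>s. blinfun_apply (T s) x)"
    by (rule continuous_on_subset[OF C0_semigroup_continuous[OF T]]) auto
  have contS: "continuous_on {0..t} (\<lambda>s. blinfun_apply (S (t - s)) y)" for y
    by (rule continuous_on_compose2[OF C0_semigroup_continuous[OF S]]) (auto intro!: continuous_intros)
  \<comment> \<open>\<open>S\<close> is known to be continuous only strongly; this bound allows
    limits of \<open>S\<close> applied to a moving vector.\<close>
  obtain B where B: "\<And>s. s \<in> {0..t} \<Longrightarrow> norm (S s) \<le> B"
    using C0_semigroup_locally_bounded[OF S] by blast
  have \<phi>: "continuous_on {0..t} \<phi>"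
    unfolding \<phi>_def by (intro continuous_intros contT)
  have "norm (u t - u 0) \<le> G t - G 0"
  proof (rule norm_increment_le_right_derivative[OF t])
    show "continuous_on {0..t} u"
      unfolding continuous_on_def u_def
    proof
      fix s assume s: "s \<in> {0..t}"
      show "((\<lambda>s. blinfun_apply (S (t - s)) (blinfun_apply (T s) x))
          \<longlongrightarrow> blinfun_apply (S (t - s)) (blinfun_apply (T s) x)) (at s within {0..t})"
      proof (rule tendsto_blinfun_apply_bounded)
        show "\<forall>\<^sub>F s in at s within {0..t}. norm (S (t - s)) \<le> B"
          by (rule eventually_at_topological[THEN iffD2]) (auto intro!: exI[of _ UNIV] B)
      qed (use contT contS s in \<open>auto simp: continuous_on_def\<close>)
    qed
    show "continuous_on {0..t} G"
      unfolding G_def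
      by (intro continuous_intros indefinite_integral_continuous_1 integrable_continuous_real \<phi>)
  next
    fix s assume s: "0 \<le> s" "s < t"
    define y where "y = blinfun_apply (T s) x"
    let ?w = "blinfun_apply F (blinfun_apply C y)"
    have y: "y \<in> D"
      unfolding y_def by (rule generates_invariant[OF T genT x s(1)])
    \<comment> \<open>Subtracting the two quotients at the same \<open>y \<in> D\<close> cancels the
      unbounded term \<open>A y\<close>.\<close>
    have "((\<lambda>h. (blinfun_apply (T h) y - y) /\<^sub>R h - (blinfun_apply (S h) y - y) /\<^sub>R h)
        \<longlongrightarrow> A y - (A y - ?w)) (at_right 0)"
      using genT genS y by (intro tendsto_diff) (auto simp: generates_def)
    then have quot: "((\<lambda>h. (blinfun_apply (T h) y - blinfun_apply (S h) y) /\<^sub>R h) \<longlongrightarrow> ?w) (at_right 0)"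
      by (simp add: scaleR_diff_right)
    have small: "\<forall>\<^sub>F h in at_right 0. 0 < h \<and> h < t - s"
      using s by (auto simp: eventually_at_right_field intro!: exI[of _ "t - s"])
    \<comment> \<open>Since \<open>S (t - s)\<close> is \<open>S (t - s - h)\<close> after
      \<open>S h\<close>, this is the difference quotient of \<open>u\<close> at
      \<open>s\<close>.\<close>
    have "((\<lambda>h. blinfun_apply (S (t - s - h)) ((blinfun_apply (T h) y - blinfun_apply (S h) y) /\<^sub>R h))
        \<longlongrightarrow> blinfun_apply (S (t - s)) ?w) (at_right 0)"
    proof (rule tendsto_blinfun_apply_bounded[OF _ _ quot])
      show "\<forall>\<^sub>F h in at_right 0. norm (S (t - s - h)) \<le> B"
        using small by eventually_elim (use s in \<open>auto intro!: B\<close>)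
      have "((\<lambda>r. blinfun_apply (S (t - r)) ?w) \<longlongrightarrow> blinfun_apply (S (t - s)) ?w) (at_right s)"
        by (rule continuous_on_Icc_at_rightD)
          (rule continuous_on_subset[OF contS], use s in auto)
      then show "((\<lambda>h. blinfun_apply (S (t - s - h)) ?w) \<longlongrightarrow> blinfun_apply (S (t - s)) ?w) (at_right 0)"
        by (subst (asm) filterlim_at_right_to_0) (simp add: algebra_simps)
    qed
    moreover have "\<forall>\<^sub>F h in at_right 0.
        blinfun_apply (S (t - s - h)) ((blinfun_apply (T h) y - blinfun_apply (S h) y) /\<^sub>R h)
        = (u (s + h) - u s) /\<^sub>R h"
      using small
    proof eventually_elim
      case (elim h)
      have "T (s + h) = T (h + s)"
        by (simp add: add.commute)
      then have "blinfun_apply (T (s + h)) x = blinfun_apply (T h) y"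
        using C0_semigroup_add[OF T, of h s x] elim s by (simp add: y_def)
      moreover have "blinfun_apply (S (t - s)) y = blinfun_apply (S (t - s - h)) (blinfun_apply (S h) y)"
        using C0_semigroup_add[OF S, of "t - s - h" h y] elim by simp
      ultimately show ?case
        by (simp add: u_def y_def blinfun.scaleR_right blinfun.diff_right diff_diff_eq)
    qed
    ultimately show "((\<lambda>h. (u (s + h) - u s) /\<^sub>R h) \<longlongrightarrow>
        blinfun_apply (S (t - s)) (blinfun_apply F (blinfun_apply C (blinfun_apply (T s) x)))) (at_right 0)"
      unfolding y_def by (rule Lim_transform_eventually)
    have "((\<lambda>h. (M * norm F * exp (- \<epsilon> * t)) * ((integral {0..s + h} \<phi> - integral {0..s} \<phi>) /\<^sub>R h))
        \<longlongrightarrow> (M * norm F * exp (- \<epsilon> * t)) * \<phi> s) (at_right 0)"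
      by (intro tendsto_intros integral_has_right_derivative[OF \<phi>] s)
    then show "((\<lambda>h. (G (s + h) - G s) / h) \<longlongrightarrow> M * norm F * exp (- \<epsilon> * t) * \<phi> s) (at_right 0)"
      by (simp add: G_def field_simps)
    have "norm (blinfun_apply (S (t - s)) ?w) \<le> norm (S (t - s)) * norm ?w"
      by (rule norm_blinfun)
    also have "\<dots> \<le> (M * exp (- \<epsilon> * (t - s))) * (norm F * norm (blinfun_apply C y))"
      using s by (intro mult_mono norm_blinfun bound order_trans[OF norm_ge_zero bound]) auto
    also have "\<dots> = M * norm F * exp (- \<epsilon> * t) * \<phi> s"
      by (simp add: \<phi>_def y_def algebra_simps flip: exp_add)
    finally show "norm (blinfun_apply (S (t - s)) (blinfun_apply F (blinfun_apply C (blinfun_apply (T s) x))))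
        \<le> M * norm F * exp (- \<epsilon> * t) * \<phi> s"
      by (simp add: y_def)
  qed
  moreover have "u t = blinfun_apply (T t) x"
    by (simp add: u_def C0_semigroup_zero[OF S])
  moreover have "u 0 = blinfun_apply (S t) x"
    by (simp add: u_def C0_semigroup_zero[OF T])
  moreover have "G 0 = 0"
    by (simp add: G_def)
  moreover have "norm (blinfun_apply (S t) x) \<le> M * exp (- \<epsilon> * t) * norm x"
    using norm_blinfun[of "S t" x] bound[OF t] by (meson mult_right_mono norm_ge_zero order_trans)
  ultimately have "norm (blinfun_apply (T t) x) \<le> M * exp (- \<epsilon> * t) * norm x + G t"
    using norm_triangle_sub[of "blinfun_apply (T t) x" "blinfun_apply (S t) x"] by simp
  then show ?thesis
    by (simp add: G_def \<phi>_def[abs_def] algebra_simps)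
qed

text \<open>The integral term is Lipschitz in \<open>x\<close>, so the estimate defines a closed set
  of vectors; this set contains the dense domain.\<close>

lemma feedback_estimate:
  fixes T S :: "real \<Rightarrow> 'a::banach \<Rightarrow>\<^sub>L 'a" and F :: "'n::real_normed_vector \<Rightarrow>\<^sub>L 'a"
  assumes T: "C0_semigroup T" and S: "C0_semigroup S"
    and genT: "generates D A T"
    and genS: "generates D (\<lambda>x. A x - blinfun_apply F (blinfun_apply C x)) S"
    and bound: "\<And>t. 0 \<le> t \<Longrightarrow> norm (S t) \<le> M * exp (- \<epsilon> * t)"
    and t: "0 \<le> t"
  shows "norm (blinfun_apply (T t) x) \<le> exp (- \<epsilon> * t) * (M * norm x +
    M * norm F * integral {0..t} (\<lambda>s. exp (\<epsilon> * s) * norm (blinfun_apply C (blinfun_apply (T s) x))))"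
proof -
  define J where "J x = integral {0..t} (\<lambda>s. exp (\<epsilon> * s) * norm (blinfun_apply C (blinfun_apply (T s) x)))" for x
  define R where "R x = exp (- \<epsilon> * t) * (M * norm x + M * norm F * J x)" for x
  have cont: "continuous_on {0..t} (\<lambda>s. blinfun_apply (T s) x)" for x
    by (rule continuous_on_subset[OF C0_semigroup_continuous[OF T]]) auto
  obtain B where B: "B \<ge> 0" "\<And>s. s \<in> {0..t} \<Longrightarrow> norm (T s) \<le> B"
    using C0_semigroup_locally_bounded[OF T] by blast
  \<comment> \<open>A Lipschitz constant of \<open>J\<close>: the first factor dominates the weight
    on \<open>{0..t}\<close> for either sign of \<open>\<epsilon>\<close>, and the last is the
    length of the interval.\<close>
  define L where "L = exp (\<bar>\<epsilon>\<bar> * t) * norm C * B * t"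
  have J_le: "J x \<le> J y + L * dist x y" for x y
  proof -
    have "J x \<le> integral {0..t} (\<lambda>s. exp (\<epsilon> * s) * norm (blinfun_apply C (blinfun_apply (T s) y))
        + exp (\<bar>\<epsilon>\<bar> * t) * norm C * B * dist x y)"
      unfolding J_def
    proof (rule integral_le)
      fix s assume s: "s \<in> {0..t}"
      have "norm (blinfun_apply C (blinfun_apply (T s) x))
          \<le> norm (blinfun_apply C (blinfun_apply (T s) y)) + norm (blinfun_apply C (blinfun_apply (T s) (x - y)))"
        using norm_triangle_sub by (metis blinfun.diff_right)
      moreover have "norm (blinfun_apply C (blinfun_apply (T s) (x - y))) \<le> norm C * (B * dist x y)"
      proof -
        have "norm (blinfun_apply (T s) (x - y)) \<le> norm (T s) * norm (x - y)"
          by (rule norm_blinfun)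
        also have "\<dots> \<le> B * dist x y"
          unfolding dist_norm by (intro mult_right_mono B s norm_ge_zero)
        finally show ?thesis
          using norm_blinfun[of C "blinfun_apply (T s) (x - y)"]
          by (meson mult_left_mono norm_ge_zero order_trans)
      qed
      ultimately have "exp (\<epsilon> * s) * norm (blinfun_apply C (blinfun_apply (T s) x))
          \<le> exp (\<epsilon> * s) * norm (blinfun_apply C (blinfun_apply (T s) y)) + exp (\<epsilon> * s) * (norm C * (B * dist x y))"
        by (simp flip: distrib_left)
      also have "exp (\<epsilon> * s) * (norm C * (B * dist x y)) \<le> exp (\<bar>\<epsilon>\<bar> * t) * (norm C * (B * dist x y))"
        using s B by (intro mult_right_mono) (auto intro!: mult_mono)
      finally show "exp (\<epsilon> * s) * norm (blinfun_apply C (blinfun_apply (T s) x))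
          \<le> exp (\<epsilon> * s) * norm (blinfun_apply C (blinfun_apply (T s) y)) + exp (\<bar>\<epsilon>\<bar> * t) * norm C * B * dist x y"
        by (simp add: mult.assoc)
    qed (intro integrable_continuous_real continuous_intros cont)+
    also have "\<dots> = J y + L * dist x y"
      unfolding J_def using t
      by (subst integral_add) (auto simp: L_def intro!: integrable_continuous_real continuous_intros cont)
    finally show ?thesis .
  qed
  have "L-lipschitz_on UNIV J"
  proof (rule lipschitz_onI)
    show "dist (J x) (J y) \<le> L * dist x y" for x y
      using J_le[of x y] J_le[of y x] by (simp add: dist_real_def dist_commute abs_le_iff)
    show "0 \<le> L"
      using B t by (simp add: L_def)
  qed
  then have "continuous_on UNIV J"
    by (rule lipschitz_on_continuous_on)
  then have "closed {x. norm (blinfun_apply (T t) x) \<le> R x}"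
    unfolding R_def by (intro closed_Collect_le continuous_intros)
  moreover have "D \<subseteq> {x. norm (blinfun_apply (T t) x) \<le> R x}"
    unfolding R_def J_def using feedback_estimate_domain[OF T S genT genS bound _ t] by blast
  ultimately have "x \<in> {x. norm (blinfun_apply (T t) x) \<le> R x}"
    using closure_minimal generator_domain_dense[OF T genT] by blast
  then show ?thesis
    by (simp add: R_def J_def)
qed

section \<open>Square integrals of the scalar majorant and over the half-line\<close>

text \<open>A Lyapunov argument for \<open>b' = - \<epsilon> b + K f\<close> with
  \<open>b 0 = c\<close>: the energy \<open>E\<close>, which is the square of \<open>b\<close> plus
  accumulated dissipation minus accumulated input, never increases.\<close>

lemma exponential_convolution_L2_bound:
  fixes f :: "real \<Rightarrow> real"
  assumes f: "continuous_on {0..t} f" and \<epsilon>: "\<epsilon> > 0" and t: "0 \<le> t"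
  shows "integral {0..t} (\<lambda>s. (exp (- \<epsilon> * s) * (c + K * integral {0..s} (\<lambda>r. exp (\<epsilon> * r) * f r)))\<^sup>2)
    \<le> (c\<^sup>2 + K\<^sup>2 / \<epsilon> * integral {0..t} (\<lambda>s. (f s)\<^sup>2)) / \<epsilon>"
proof -
  define I where "I s = integral {0..s} (\<lambda>r. exp (\<epsilon> * r) * f r)" for s
  define b where "b s = exp (- \<epsilon> * s) * (c + K * I s)" for s
  have dI: "(I has_real_derivative exp (\<epsilon> * s) * f s) (at s within {0..t})" if "s \<in> {0..t}" for s
    unfolding I_def by (rule integral_has_real_derivative) (intro continuous_intros f that)+
  have db: "(b has_real_derivative - \<epsilon> * b s + K * f s) (at s within {0..t})" if "s \<in> {0..t}" for s
    unfolding b_def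
    by (auto intro!: derivative_eq_intros dI[OF that] simp: algebra_simps simp flip: exp_add)
  have contb: "continuous_on {0..t} b"
    by (rule DERIV_continuous_on) (rule db)
  \<comment> \<open>The coefficients complete the square: \<open>2 * b * (- \<epsilon> * b + K * f)
    + \<epsilon> * b\<^sup>2 - K\<^sup>2 / \<epsilon> * f\<^sup>2\<close> equals
    \<open>- (\<epsilon> * b - K * f)\<^sup>2 / \<epsilon>\<close>.\<close>
  define E where "E s = (b s)\<^sup>2 + \<epsilon> * integral {0..s} (\<lambda>r. (b r)\<^sup>2) - K\<^sup>2 / \<epsilon> * integral {0..s} (\<lambda>r. (f r)\<^sup>2)" for s
  have dE: "(E has_real_derivative - (\<epsilon> * b s - K * f s)\<^sup>2 / \<epsilon>) (at s within {0..t})" if "s \<in> {0..t}" for s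
    unfolding E_def
    by (rule derivative_eq_intros db integral_has_real_derivative continuous_intros contb f that refl)+
      (use \<epsilon> in \<open>simp add: field_simps power2_eq_square\<close>)
  have "E t \<le> E 0"
  proof (rule DERIV_nonpos_imp_decreasing_open[OF t])
    show "continuous_on {0..t} E"
      by (rule DERIV_continuous_on) (rule dE)
    fix s assume s: "0 < s" "s < t"
    then show "\<exists>y. (E has_real_derivative y) (at s) \<and> y \<le> 0"
      using dE[of s] \<epsilon> by (intro exI[of _ "- (\<epsilon> * b s - K * f s)\<^sup>2 / \<epsilon>"]) (auto simp: at_within_Icc_at)
  qed
  moreover have "E 0 = c\<^sup>2"
    by (simp add: E_def b_def I_def)
  ultimately have "\<epsilon> * integral {0..t} (\<lambda>r. (b r)\<^sup>2) \<le> c\<^sup>2 + K\<^sup>2 / \<epsilon> * integral {0..t} (\<lambda>r. (f r)\<^sup>2)"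
    using zero_le_power2[of "b t"] unfolding E_def by linarith
  then show ?thesis
    using \<epsilon> by (simp add: b_def I_def field_simps)
qed

text \<open>Translates the extended integrals of \<open>detectable_L2\<close> into bounds on
  ordinary integrals that are uniform in \<open>n\<close>. One direction is monotonicity in the set,
  the other monotone convergence.\<close>

lemma nn_integral_half_line_finite_iff:
  fixes g :: "real \<Rightarrow> real"
  assumes g: "continuous_on {0..} g" and nonneg: "\<And>t. 0 \<le> t \<Longrightarrow> 0 \<le> g t"
  shows "(\<integral>\<^sup>+t\<in>{0..}. ennreal (g t) \<partial>lborel) < \<infinity> \<longleftrightarrow> (\<exists>B. \<forall>n::nat. integral {0..real n} g \<le> B)"
proof -
  have eq: "(\<integral>\<^sup>+t\<in>{0..real n}. ennreal (g t) \<partial>lborel) = ennreal (integral {0..real n} g)" for n :: nat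
    by (rule nn_integral_has_integral_lebesgue')
      (auto intro!: nonneg integrable_integral integrable_continuous_real continuous_on_subset[OF g])
  have int_nonneg: "0 \<le> integral {0..real n} g" for n :: nat
    by (rule integral_nonneg)
      (auto intro!: nonneg integrable_continuous_real continuous_on_subset[OF g])
  show ?thesis
  proof
    assume fin: "(\<integral>\<^sup>+t\<in>{0..}. ennreal (g t) \<partial>lborel) < \<infinity>"
    have "integral {0..real n} g \<le> enn2real (\<integral>\<^sup>+t\<in>{0..}. ennreal (g t) \<partial>lborel)" for n :: nat
    proof -
      have "ennreal (integral {0..real n} g) \<le> (\<integral>\<^sup>+t\<in>{0..}. ennreal (g t) \<partial>lborel)"
        unfolding eq[symmetric] by (rule nn_set_integral_set_mono) auto
      then have "enn2real (ennreal (integral {0..real n} g)) \<le> enn2real (\<integral>\<^sup>+t\<in>{0..}. ennreal (g t) \<partial>lborel)"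
        using fin by (intro enn2real_mono) auto
      then show ?thesis
        using int_nonneg by simp
    qed
    then show "\<exists>B. \<forall>n::nat. integral {0..real n} g \<le> B"
      by blast
  next
    assume "\<exists>B. \<forall>n::nat. integral {0..real n} g \<le> B"
    then obtain B where B: "\<And>n::nat. integral {0..real n} g \<le> B"
      by blast
    have "(\<lambda>n. \<integral>\<^sup>+t\<in>{0..real n}. ennreal (g t) \<partial>lborel) \<longlonglongrightarrow> (\<integral>\<^sup>+t\<in>{0..}. ennreal (g t) \<partial>lborel)"
    proof (rule nn_integral_LIMSEQ)
      show "incseq (\<lambda>n t. ennreal (g t) * indicator {0..real n} t)"
        by (auto simp: incseq_def le_fun_def split: split_indicator)
      fix n :: nat
      \<comment> \<open>Continuity of \<open>g\<close> is given on the half-line, so measurability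
        is obtained for its truncation to a closed interval.\<close>
      have "(\<lambda>t. indicator {0..real n} t *\<^sub>R g t) \<in> borel_measurable borel"
        by (intro borel_measurable_continuous_on_indicator continuous_on_subset[OF g]) auto
      then have "(\<lambda>t. ennreal (indicator {0..real n} t *\<^sub>R g t)) \<in> borel_measurable lborel"
        by simp
      also have "(\<lambda>t. ennreal (indicator {0..real n} t *\<^sub>R g t)) = (\<lambda>t. ennreal (g t) * indicator {0..real n} t)"
        by (auto split: split_indicator)
      finally show "(\<lambda>t. ennreal (g t) * indicator {0..real n} t) \<in> borel_measurable lborel" .
    next
      fix t :: real
      obtain N where N: "t \<le> real N"
        using real_arch_simple by blast
      have "\<forall>\<^sub>F n in sequentially. ennreal (g t) * indicator {0..real n} t = ennreal (g t) * indicator {0..} t"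
        using eventually_ge_at_top[of N] by eventually_elim (use N in \<open>auto split: split_indicator\<close>)
      then show "(\<lambda>n. ennreal (g t) * indicator {0..real n} t) \<longlonglongrightarrow> ennreal (g t) * indicator {0..} t"
        by (rule tendsto_eventually)
    qed
    then have "(\<integral>\<^sup>+t\<in>{0..}. ennreal (g t) \<partial>lborel) \<le> ennreal B"
      by (rule LIMSEQ_le_const2) (auto simp: eq intro!: ennreal_leI B)
    then show "(\<integral>\<^sup>+t\<in>{0..}. ennreal (g t) \<partial>lborel) < \<infinity>"
      using le_less_trans by fastforce
  qed
qed

section \<open>From the estimates to detectability\<close>

theorem theorem8:
  fixes T :: "real \<Rightarrow> 'x::banach \<Rightarrow>\<^sub>L 'x"
    and D :: "'x set" and A :: "'x \<Rightarrow> 'x"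
    and C :: "'x \<Rightarrow>\<^sub>L 'n::{real_inner, complete_space}"
  assumes "reflexive_space TYPE('x)"
    and "C0_semigroup T"
    and "generates D A T"
    and "exponentially_detectable C D A"
  shows "detectable_L2 C T"
  unfolding detectable_L2_def
proof (intro allI impI)
  fix x
  note T = assms(2)
  obtain F S where S: "C0_semigroup S"
    and genS: "generates D (\<lambda>x. A x - blinfun_apply F (blinfun_apply C x)) S"
    and "exponentially_stable S"
    using assms(4) by (auto simp: exponentially_detectable_def)
  then obtain M \<epsilon> where \<epsilon>: "\<epsilon> > 0" and bound: "\<And>t. 0 \<le> t \<Longrightarrow> norm (S t) \<le> M * exp (- \<epsilon> * t)"
    by (auto simp: exponentially_stable_def)
  define f where "f t = norm (blinfun_apply C (blinfun_apply (T t) x))" for t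
  \<comment> \<open>The majorant of the orbit, in the shape of the convolution bound with
    \<open>c = M * norm x\<close> and \<open>K = M * norm F\<close>.\<close>
  define b where "b t = exp (- \<epsilon> * t) * (M * norm x + M * norm F * integral {0..t} (\<lambda>s. exp (\<epsilon> * s) * f s))" for t
  have contT: "continuous_on {0..} (\<lambda>t. blinfun_apply (T t) x)"
    by (rule C0_semigroup_continuous[OF T])
  have contf: "continuous_on {0..} f"
    unfolding f_def by (intro continuous_intros contT)
  have contT_Icc: "continuous_on {0..t} (\<lambda>t. blinfun_apply (T t) x)" for t
    by (rule continuous_on_subset[OF contT]) auto
  have contf_Icc: "continuous_on {0..t} f" for t
    by (rule continuous_on_subset[OF contf]) auto
  assume "(\<integral>\<^sup>+t\<in>{0..}. ennreal ((norm (blinfun_apply C (blinfun_apply (T t) x)))\<^sup>2) \<partial>lborel) < \<infinity>"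
  then have "(\<integral>\<^sup>+t\<in>{0..}. ennreal ((f t)\<^sup>2) \<partial>lborel) < \<infinity>"
    by (simp add: f_def)
  then obtain B where B: "\<And>n::nat. integral {0..real n} (\<lambda>t. (f t)\<^sup>2) \<le> B"
    using nn_integral_half_line_finite_iff[of "\<lambda>t. (f t)\<^sup>2"] contf by (auto intro: continuous_intros)
  \<comment> \<open>The right-hand side is independent of \<open>n\<close>, as the finiteness
    criterion on the half-line demands.\<close>
  have "integral {0..real n} (\<lambda>t. (norm (blinfun_apply (T t) x))\<^sup>2)
      \<le> ((M * norm x)\<^sup>2 + (M * norm F)\<^sup>2 / \<epsilon> * B) / \<epsilon>" for n :: nat
  proof -
    have "integral {0..real n} (\<lambda>t. (norm (blinfun_apply (T t) x))\<^sup>2) \<le> integral {0..real n} (\<lambda>t. (b t)\<^sup>2)"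
    proof (rule integral_le)
      show "(\<lambda>t. (norm (blinfun_apply (T t) x))\<^sup>2) integrable_on {0..real n}"
        by (intro integrable_continuous_real continuous_intros contT_Icc)
      show "(\<lambda>t. (b t)\<^sup>2) integrable_on {0..real n}"
        unfolding b_def
        by (intro integrable_continuous_real continuous_intros indefinite_integral_continuous_1 contf_Icc)
      fix t assume "t \<in> {0..real n}"
      then show "(norm (blinfun_apply (T t) x))\<^sup>2 \<le> (b t)\<^sup>2"
        using feedback_estimate[OF T S assms(3) genS bound, of t x]
        by (intro power_mono) (auto simp: b_def f_def)
    qed
    also have "\<dots> \<le> ((M * norm x)\<^sup>2 + (M * norm F)\<^sup>2 / \<epsilon> * integral {0..real n} (\<lambda>t. (f t)\<^sup>2)) / \<epsilon>"
      unfolding b_def by (rule exponential_convolution_L2_bound[OF contf_Icc \<epsilon>]) simp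
    also have "\<dots> \<le> ((M * norm x)\<^sup>2 + (M * norm F)\<^sup>2 / \<epsilon> * B) / \<epsilon>"
      using \<epsilon> by (intro divide_right_mono add_left_mono mult_left_mono B) auto
    finally show ?thesis .
  qed
  then show "(\<integral>\<^sup>+t\<in>{0..}. ennreal ((norm (blinfun_apply (T t) x))\<^sup>2) \<partial>lborel) < \<infinity>"
    by (subst nn_integral_half_line_finite_iff) (auto intro!: continuous_intros contT)
qed

end
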